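(* Let $n \geq 2$ be an even integer and let $m \geq 2$ be an integer. Let $L_m(n)$ be the length $\mathrm{Len}(0,0,\ldots,0,1)$ of the tuple $(0,0,\ldots,0,1) \in \mathbb{Z}_m^n$ under the Ducci function $D$ on $\mathbb{Z}_m^n$. Then: \begin{enumerate} \item If $\gcd(n,m)=1$, then $L_m(n)=1$. \item If there exist a prime $p$ and positive integers $k, n_1, m_1$ such that $n=p^k n_1$, $m=p m_1$, $\gcd(n_1,m_1)=1$, $p \nmid n_1$ and $p \nmid m_1$, then $L_m(n)=p^k$. \item If there exist a prime $p$ and positive integers $k, l, n_1, m_1$ such that $n=p^k n_1$, $m=p^l m_1$, $\gcd(n_1,m_1)=1$, $p \nmid n_1$ and $p \nmid m_1$, then $L_m(n) \leq p^{k-1}\left(l(p-1)+1\right)$. \item If there exist an integer $t \geq 1$, primes $p_1<p_2<\cdots<p_t$, and positive integers $k_1,\ldots,k_t$, $l_1,\ldots,l_t$, $n_1$, $m_1$ such that $n=p_1^{k_1}p_2^{k_2}\cdots p_t^{k_t}n_1$, $m=p_1^{l_1}p_2^{l_2}\cdots p_t^{l_t}m_1$, $\gcd(n_1,m_1)=1$, and $p_i \nmid n_1$, $p_i \nmid m_1$ for every $1 \leq i \leq t$, then \[L_m(n)=\max\{L_{p_i^{l_i}}(n) \mid 1 \leq i \leq t\}.\] \end{enumerate}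
   Context: For positive integers $m, n$, with $\mathbb{Z}_m$ the integers modulo $m$, the Ducci function $D:\mathbb{Z}_m^n\to\mathbb{Z}_m^n$ is the endomorphism \[D(x_1,x_2,\ldots,x_n)=(x_1+x_2 \bmod m,\; x_2+x_3 \bmod m,\; \ldots,\; x_n+x_1 \bmod m).\] The Ducci sequence of $\mathbf{u}\in\mathbb{Z}_m^n$ is $\{D^{\alpha}(\mathbf{u})\}_{\alpha=0}^{\infty}$. Since $\mathbb{Z}_m^n$ is finite, it eventually enters a cycle. The length of $\mathbf{u}$, denoted $\mathrm{Len}(\mathbf{u})$, is the smallest integer $\alpha\geq 0$ such that $D^{\alpha+\beta}(\mathbf{u})=D^{\alpha}(\mathbf{u})$ for some integer $\beta\geq 1$. For each modulus $m$ one sets $L_m(n)=\mathrm{Len}(0,0,\ldots,0,1)$, computed for the tuple $(0,0,\ldots,0,1)\in\mathbb{Z}_m^n$ with $D$ acting on $\mathbb{Z}_m^n$. *)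

theory Defs
  imports Complex_Main "HOL-Computational_Algebra.Primes"
begin

text \<open>Tuples over the integers modulo \<open>m\<close> are lists of length \<open>n\<close> of the canonical
  representatives \<open>0, \<dots>, m - 1\<close>; list position \<open>i\<close> holds the entry \<open>x\<close> with index \<open>i + 1\<close>.\<close>

definition Zmod_tuples :: "nat \<Rightarrow> nat \<Rightarrow> nat list set" where
  "Zmod_tuples m n = {xs. length xs = n \<and> set xs \<subseteq> {0..<m}}"

definition ducci :: "nat \<Rightarrow> nat list \<Rightarrow> nat list" where
  "ducci m xs = map (\<lambda>i. (xs ! i + xs ! (Suc i mod length xs)) mod m) [0..<length xs]"

definition ducci_Len :: "nat \<Rightarrow> nat list \<Rightarrow> nat" where
  "ducci_Len m u = (LEAST \<alpha>. \<exists>\<beta>\<ge>1. (ducci m ^^ (\<alpha> + \<beta>)) u = (ducci m ^^ \<alpha>) u)"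

text \<open>The reduction of the last entry matters only for \<open>m = 1\<close>, where \<open>1 = 0\<close>.\<close>

definition ducci_L :: "nat \<Rightarrow> nat \<Rightarrow> nat" where
  "ducci_L m n = ducci_Len m (replicate (n - 1) 0 @ [1 mod m])"

lemma ducci_closed:
  assumes "m \<ge> 1" "u \<in> Zmod_tuples m n"
  shows "ducci m u \<in> Zmod_tuples m n"
  using assms by (auto simp: Zmod_tuples_def ducci_def)

lemma ducci_funpow_closed:
  assumes "m \<ge> 1" "u \<in> Zmod_tuples m n"
  shows "(ducci m ^^ \<alpha>) u \<in> Zmod_tuples m n"
  using assms by (induction \<alpha>) (auto intro: ducci_closed)

lemma basic_tuple_in_Zmod_tuples:
  assumes "m \<ge> 1" "n \<ge> 1"
  shows "replicate (n - 1) 0 @ [1 mod m] \<in> Zmod_tuples m n"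
  using assms by (auto simp: Zmod_tuples_def)

text \<open>The set whose least element is taken in \<open>ducci_Len\<close> is nonempty.\<close>

lemma ducci_Len_exists:
  assumes "m \<ge> 1" "u \<in> Zmod_tuples m n"
  shows "\<exists>\<alpha> \<beta>. \<beta> \<ge> 1 \<and> (ducci m ^^ (\<alpha> + \<beta>)) u = (ducci m ^^ \<alpha>) u"
proof -
  have "finite (Zmod_tuples m n)"
    using finite_lists_length_eq[of "{0..<m}" n]
    by (simp add: Zmod_tuples_def conj_commute)
  moreover have "range (\<lambda>\<alpha>. (ducci m ^^ \<alpha>) u) \<subseteq> Zmod_tuples m n"
    using ducci_funpow_closed[OF assms] by auto
  ultimately have "finite (range (\<lambda>\<alpha>. (ducci m ^^ \<alpha>) u))"
    by (rule finite_subset[rotated])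
  then have "\<not> inj (\<lambda>\<alpha>. (ducci m ^^ \<alpha>) u)"
    using finite_imageD infinite_UNIV_nat by blast
  then obtain a b where "a < b" "(ducci m ^^ a) u = (ducci m ^^ b) u"
    unfolding inj_def by (metis linorder_neqE_nat)
  then show ?thesis
    by (intro exI[of _ a] exI[of _ "b - a"]) auto
qed

end

theory Submission
  imports Defs "HOL-Computational_Algebra.Polynomial"
begin

text \<open>A tuple \<open>(x\<^sub>1, \<dots>, x\<^sub>n)\<close> is identified with \<open>\<Sum> x\<^sub>i X ^ (n - i)\<close> in \<open>\<int>[X] / (m, X ^ n - 1)\<close>; then
  \<open>(0, \<dots>, 0, 1)\<close> is \<open>1\<close> and the Ducci map is multiplication by \<open>z = 1 + X\<close>. So \<open>L\<^sub>m(n) \<le> a\<close> iff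
  \<open>z ^ a * (z ^ b - 1)\<close> lies in the ideal \<open>(m, X ^ n - 1)\<close> for some \<open>b \<ge> 1\<close>, and coprime moduli can be
  treated separately. As \<open>n\<close> is even, \<open>Y = - X\<close> satisfies \<open>Y ^ n = X ^ n\<close>, and \<open>z = 1 - Y\<close>. If
  \<open>n = q n\<^sub>1\<close> with \<open>n\<^sub>1\<close> coprime to \<open>m\<close>, then \<open>Y ^ n - 1 = (Y ^ q - 1) g\<close> with \<open>z\<close> a unit modulo
  \<open>(m, g)\<close>, so \<open>L\<^sub>m(n)\<close> is at most any \<open>N\<close> with \<open>z ^ N \<in> (m, Y ^ q - 1)\<close>. For \<open>q = p ^ k\<close>,
  \<open>m = p ^ l\<close> such an \<open>N\<close> comes from the fact that \<open>z ^ p ^ (k - 1)\<close> behaves like an element of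
  valuation \<open>1 / (p - 1)\<close>. Modulo \<open>p\<close> one has \<open>Y ^ p ^ k - 1 = (Y - 1) ^ p ^ k\<close>, hence
  \<open>L\<^sub>p(n) \<ge> p ^ k\<close>.\<close>

section \<open>Congruences modulo two elements of a commutative ring\<close>

definition ideal2 :: "'a::comm_ring_1 \<Rightarrow> 'a \<Rightarrow> 'a set" where
  "ideal2 a b = {x. \<exists>u v. x = a * u + b * v}"

lemma ideal2I: "x = a * u + b * v \<Longrightarrow> x \<in> ideal2 a b"
  by (auto simp: ideal2_def)

lemma ideal2E:
  assumes "x \<in> ideal2 a b"
  obtains u v where "x = a * u + b * v"
  using assms by (auto simp: ideal2_def)

lemma ideal2_add:
  assumes "x \<in> ideal2 a b" "y \<in> ideal2 a b"
  shows "x + y \<in> ideal2 a b"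
proof -
  obtain u v u' v' where "x = a * u + b * v" "y = a * u' + b * v'"
    using assms by (elim ideal2E)
  then show ?thesis by (intro ideal2I[of _ _ "u + u'" _ "v + v'"]) (simp add: algebra_simps)
qed

lemma ideal2_mult:
  assumes "x \<in> ideal2 a b"
  shows "c * x \<in> ideal2 a b"
proof -
  obtain u v where "x = a * u + b * v"
    using assms by (elim ideal2E)
  then show ?thesis by (intro ideal2I[of _ _ "c * u" _ "c * v"]) (simp add: algebra_simps)
qed

lemma ideal2_diff:
  assumes "x \<in> ideal2 a b" "y \<in> ideal2 a b"
  shows "x - y \<in> ideal2 a b"
  using ideal2_add[OF assms(1) ideal2_mult[OF assms(2), of "-1"]] by simp

lemma ideal2_mono:
  assumes "x \<in> ideal2 a b" "a' dvd a" "b' dvd b"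
  shows "x \<in> ideal2 a' b'"
proof -
  obtain u v c d where "x = a * u + b * v" "a = a' * c" "b = b' * d"
    using assms by (elim ideal2E dvdE)
  then show ?thesis by (intro ideal2I[of _ _ "c * u" _ "d * v"]) (simp add: algebra_simps)
qed

lemma coprime_bezout_of_int:
  assumes "coprime a (b::nat)"
  obtains s t :: int where
    "of_int s * of_nat a + of_int t * of_nat b = (1::'a::comm_ring_1)"
proof -
  obtain s t where "s * int a + t * int b = 1"
    using bezout_int[of "int a" "int b"] assms by auto
  then have "of_int (s * int a + t * int b) = (1::'a)" by simp
  then show ?thesis using that by simp
qed

text \<open>With \<open>s * a + t * b = 1\<close>, split \<open>x\<close> into
  \<open>s * a * x + t * b * x\<close> and expand each \<open>x\<close> by its membership for the
  other modulus; both summands then carry \<open>a * b\<close> up to multiples of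
  \<open>h\<close>.\<close>

lemma ideal2_coprime_iff:
  fixes x :: "'a::comm_ring_1"
  assumes "coprime a b"
  shows "x \<in> ideal2 (of_nat (a * b)) h \<longleftrightarrow> x \<in> ideal2 (of_nat a) h \<and> x \<in> ideal2 (of_nat b) h"
proof safe
  assume "x \<in> ideal2 (of_nat a) h" "x \<in> ideal2 (of_nat b) h"
  then obtain u v u' v' where *: "x = of_nat a * u + h * v" "x = of_nat b * u' + h * v'"
    by (elim ideal2E)
  obtain s t :: int where st: "of_int s * of_nat a + of_int t * of_nat b = (1::'a)"
    using coprime_bezout_of_int[OF assms] .
  have "x = (of_int s * of_nat a + of_int t * of_nat b) * x" using st by simp
  also have "\<dots> = of_int s * of_nat a * (of_nat b * u' + h * v')
      + of_int t * of_nat b * (of_nat a * u + h * v)"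
    using * by (simp add: algebra_simps)
  also have "\<dots> = of_nat (a * b) * (of_int s * u' + of_int t * u)
      + h * (of_int s * of_nat a * v' + of_int t * of_nat b * v)"
    by (simp add: algebra_simps)
  finally show "x \<in> ideal2 (of_nat (a * b)) h" by (rule ideal2I)
qed (auto elim!: ideal2_mono)

section \<open>Powers with prime exponent\<close>

text \<open>The inner binomial coefficients are divisible by \<open>p\<close>, the inner monomials
  by \<open>a * b\<close>. The factor \<open>a * b\<close> is kept because a mere congruence modulo
  \<open>p\<close> would lose it.\<close>

lemma add_power_prime:
  fixes a b :: "'a::comm_ring_1"
  assumes "prime p"
  obtains u where "(a + b) ^ p = a ^ p + b ^ p + of_nat p * a * b * u"
proof -
  have p2: "p \<ge> 2" using assms by (rule prime_ge_2_nat)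
  have "(a + b) ^ p = (\<Sum>i\<in>{..p}. of_nat (p choose i) * a ^ i * b ^ (p - i))"
    by (rule binomial_ring)
  also have "{..p} = insert 0 (insert p {0<..<p})" using p2 by auto
  also have "(\<Sum>i\<in>\<dots>. of_nat (p choose i) * a ^ i * b ^ (p - i)) =
     a ^ p + b ^ p + (\<Sum>i\<in>{0<..<p}. of_nat (p choose i) * a ^ i * b ^ (p - i))"
    using p2 by (subst sum.insert; simp)+
  also have "(\<Sum>i\<in>{0<..<p}. of_nat (p choose i) * a ^ i * b ^ (p - i)) =
     (\<Sum>i\<in>{0<..<p}. of_nat p * a * b * (of_nat ((p choose i) div p) * a ^ (i-1) * b ^ (p - i - 1)))"
  proof (rule sum.cong)
    fix i assume i: "i \<in> {0<..<p}"
    have "p dvd (p choose i)"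
      using i assms by (intro dvd_choose_prime) auto
    then have c: "(of_nat (p choose i) :: 'a) = of_nat p * of_nat ((p choose i) div p)"
      by (metis dvd_mult_div_cancel of_nat_mult)
    have ab: "a ^ i = a * a ^ (i - 1)" "b ^ (p - i) = b * b ^ (p - i - 1)"
      using i power_minus_mult[of i a] power_minus_mult[of "p - i" b]
      by (simp_all add: mult.commute)
    show "of_nat (p choose i) * a ^ i * b ^ (p - i) =
       of_nat p * a * b * (of_nat ((p choose i) div p) * a ^ (i-1) * b ^ (p - i - 1))"
      unfolding c ab by (simp only: ac_simps)
  qed simp
  finally show ?thesis using that unfolding sum_distrib_left[symmetric] by blast
qed

text \<open>This is the iterated Frobenius identity: in each further \<open>p\<close>-th power the
  error \<open>p * c\<close> yields only multiples of \<open>p\<close>.\<close>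

lemma add_one_power_prime_power:
  fixes w :: "'a::comm_ring_1"
  assumes "prime p"
  shows "\<exists>c. (w + 1) ^ (p ^ j) = w ^ (p ^ j) + 1 + of_nat p * c"
proof (induction j)
  case (Suc j)
  then obtain c where c: "(w + 1) ^ (p ^ j) = w ^ (p ^ j) + 1 + of_nat p * c" by blast
  obtain u where u: "((w ^ (p ^ j) + 1) + of_nat p * c) ^ p = (w ^ (p ^ j) + 1) ^ p
      + (of_nat p * c) ^ p + of_nat p * (w ^ (p ^ j) + 1) * (of_nat p * c) * u"
    using add_power_prime[OF assms] .
  obtain v where v: "(w ^ (p ^ j) + 1) ^ p = (w ^ (p ^ j)) ^ p + 1 ^ p
      + of_nat p * w ^ (p ^ j) * 1 * v"
    using add_power_prime[OF assms] .
  have p: "(of_nat p * c) ^ p = of_nat p * (c * (of_nat p * c) ^ (p - 1))"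
    using power_minus_mult[OF prime_gt_0_nat[OF assms], of "of_nat p * c"]
    by (simp add: ac_simps)
  have "(w + 1) ^ (p ^ Suc j) = ((w + 1) ^ (p ^ j)) ^ p"
    by (simp only: power_Suc2 power_mult)
  also have "\<dots> = w ^ (p ^ Suc j) + 1 + of_nat p * (w ^ (p ^ j) * v
      + c * (of_nat p * c) ^ (p - 1) + (w ^ (p ^ j) + 1) * of_nat p * c * u)"
    unfolding c u v p power_Suc
    by (simp add: algebra_simps power_mult[symmetric])
  finally show ?case by blast
qed (intro exI[of _ 0], simp)

text \<open>With \<open>C = (Y - 1) ^ p ^ j\<close> and \<open>h = Y ^ p ^ Suc j - 1\<close>, one has \<open>C ^ p \<in> p (C, p)\<close> modulo \<open>h\<close>:
  \<open>C\<close> differs from \<open>A = Y ^ p ^ j - 1\<close> by a multiple of \<open>p\<close>, and \<open>A ^ p\<close> from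
  \<open>(A + 1) ^ p - 1 = h\<close> by a multiple of \<open>p * A\<close>. Induction gives \<open>C ^ (l * (p - 1) + 1) \<in> p ^ l (C, p)\<close>.\<close>

lemma diff_one_power_in_ideal2:
  fixes Y :: "'a::comm_ring_1"
  assumes "prime p"
  shows "(Y - 1) ^ (p ^ j * (l * (p - 1) + 1)) \<in> ideal2 (of_nat (p ^ l)) (Y ^ (p ^ Suc j) - 1)"
proof -
  define h where "h = Y ^ (p ^ Suc j) - 1"
  define C where "C = (Y - 1) ^ (p ^ j)"
  define A where "A = Y ^ (p ^ j) - 1"
  have p2: "p \<ge> 2" using assms by (rule prime_ge_2_nat)
  obtain c where "(Y - 1 + 1) ^ (p ^ j) = (Y - 1) ^ (p ^ j) + 1 + of_nat p * c"
    using add_one_power_prime_power[OF assms] by blast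
  then have AC: "A = C + of_nat p * c" by (simp add: A_def C_def)
  obtain u where "(A + 1) ^ p = A ^ p + 1 ^ p + of_nat p * A * 1 * u"
    using add_power_prime[OF assms] .
  then have Ap: "A ^ p = h - of_nat p * A * u"
    by (simp add: A_def h_def algebra_simps power_mult[symmetric])
  obtain v where v: "(C + of_nat p * c) ^ p = C ^ p + (of_nat p * c) ^ p + of_nat p * C * (of_nat p * c) * v"
    using add_power_prime[OF assms] .
  \<comment> \<open>As \<open>p \<ge> 2\<close>, two factors \<open>p\<close> can be split off; a
    single one would not put this term into \<open>p (C, p)\<close>.\<close>
  have "(of_nat p * c) ^ p = (of_nat p * c) ^ (2 + (p - 2))"
    by (simp only: le_add_diff_inverse[OF p2])
  also have "\<dots> = of_nat p * (of_nat p * (c * c * (of_nat p * c) ^ (p - 2)))"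
    unfolding power_add power2_eq_square by (simp only: ac_simps)
  finally obtain d where d: "(of_nat p * c) ^ p = of_nat p * (of_nat p * d)" ..
  have "C ^ p = h - of_nat p * A * u - of_nat p * (of_nat p * d) - of_nat p * C * (of_nat p * c) * v"
    using v unfolding AC[symmetric] Ap d by (simp add: algebra_simps)
  also have "\<dots> = h + of_nat p * (C * (- u) + of_nat p * (- c * u - d - C * c * v))"
    unfolding AC by (simp add: algebra_simps)
  finally obtain a b where ab: "C ^ p = h + of_nat p * (C * a + of_nat p * b)" by blast
  have "\<exists>r s t. C ^ (l * (p - 1) + 1) = of_nat p ^ l * (C * r + of_nat p * s) + h * t"
  proof (induction l)
    case 0
    show ?case by (intro exI[of _ 1] exI[of _ 0]) simp
  next
    case (Suc l)
    then obtain r s t where *: "C ^ (l * (p - 1) + 1) = of_nat p ^ l * (C * r + of_nat p * s) + h * t"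
      by blast
    have C1: "C ^ (p - 1) = C * C ^ (p - 2)"
      using p2 by (simp flip: power_Suc add: Suc_diff_Suc numeral_2_eq_2)
    have Cp: "C ^ (p - 1) * C = C ^ p"
      using p2 by (intro power_minus_mult) simp
    have "Suc l * (p - 1) + 1 = (p - 1) + (l * (p - 1) + 1)" by simp
    then have "C ^ (Suc l * (p - 1) + 1) = C ^ (p - 1) * C ^ (l * (p - 1) + 1)"
      by (simp only: power_add)
    \<comment> \<open>The new factor \<open>C ^ (p - 1)\<close> completes \<open>C * r\<close> to a
      multiple of \<open>C ^ p\<close>. The other summand already has its \<open>p\<close> and needs
      only one \<open>C\<close> out of it.\<close>
    also have "\<dots> = of_nat p ^ l * ((C ^ (p - 1) * C) * r + of_nat p * s * C ^ (p - 1))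
        + h * (C ^ (p - 1) * t)"
      unfolding * by (simp add: algebra_simps)
    also have "\<dots> = of_nat p ^ l * ((h + of_nat p * (C * a + of_nat p * b)) * r
        + of_nat p * s * (C * C ^ (p - 2))) + h * (C ^ (p - 1) * t)"
      unfolding Cp ab C1[symmetric] ..
    also have "\<dots> = of_nat p ^ Suc l * (C * (a * r + s * C ^ (p - 2)) + of_nat p * (b * r))
        + h * (of_nat p ^ l * r + C ^ (p - 1) * t)"
      by (simp add: algebra_simps)
    finally show ?case by blast
  qed
  then show ?thesis
    unfolding power_mult C_def[symmetric] h_def[symmetric] by (auto simp: ideal2_def)
qed

section \<open>Tuples as residues modulo \<open>m\<close> and \<open>y ^ n - 1\<close>\<close>

definition tuple_val :: "'a::comm_ring_1 \<Rightarrow> nat list \<Rightarrow> 'a" where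
  "tuple_val y u = (\<Sum>i<length u. of_nat (u ! i) * y ^ (length u - 1 - i))"

lemma of_nat_mod_conv: "of_nat (a mod m) = (of_nat a - of_nat m * of_nat (a div m) :: 'a::comm_ring_1)"
proof -
  have "of_nat a = (of_nat (m * (a div m) + a mod m) :: 'a)" by simp
  then show ?thesis by (simp only: of_nat_add of_nat_mult) simp
qed

text \<open>Multiplication by \<open>y\<close> shifts the tuple cyclically: the first entry moves to
  \<open>y ^ n\<close>, which is congruent to 1. Reducing the entries changes the value by multiples
  of \<open>m\<close>, with quotients \<open>c i\<close>.\<close>

lemma tuple_val_ducci:
  fixes y :: "'a::comm_ring_1"
  assumes "length u = n" "n \<ge> 1"
  shows "(1 + y) * tuple_val y u - tuple_val y (ducci m u) \<in> ideal2 (of_nat m) (y ^ n - 1)"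
proof -
  obtain r where n: "n = Suc r" using assms(2) by (cases n) auto
  define c where "c i = (u ! i + u ! (Suc i mod n)) div m" for i
  define S where "S = (\<Sum>i<r. of_nat (u ! Suc i) * y ^ (r - i))"
  have "tuple_val y (ducci m u)
      = (\<Sum>i<n. (of_nat (u ! i) + of_nat (u ! (Suc i mod n)) - of_nat m * of_nat (c i)) * y ^ (r - i))"
    using assms n by (auto simp: tuple_val_def ducci_def of_nat_mod_conv c_def
        simp del: sum.lessThan_Suc upt_Suc intro!: sum.cong)
  also have "\<dots> = tuple_val y u + (\<Sum>i<n. of_nat (u ! (Suc i mod n)) * y ^ (r - i))
      - of_nat m * (\<Sum>i<n. of_nat (c i) * y ^ (r - i))"
    using assms(1) n
    by (simp add: tuple_val_def algebra_simps sum.distrib sum_subtractf sum_distrib_left del: sum.lessThan_Suc)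
  also have "(\<Sum>i<n. of_nat (u ! (Suc i mod n)) * y ^ (r - i)) = S + of_nat (u ! 0)"
    by (simp add: n S_def)
  finally have 1: "tuple_val y (ducci m u) = tuple_val y u + (S + of_nat (u ! 0))
      - of_nat m * (\<Sum>i<n. of_nat (c i) * y ^ (r - i))" .
  have "y * tuple_val y u = (\<Sum>i<Suc r. of_nat (u ! i) * (y * y ^ (r - i)))"
    using assms n by (simp add: tuple_val_def sum_distrib_left mult.left_commute del: sum.lessThan_Suc)
  also have "\<dots> = of_nat (u ! 0) * y ^ n + (\<Sum>i<r. of_nat (u ! Suc i) * (y * y ^ (r - Suc i)))"
    by (subst sum.lessThan_Suc_shift) (simp add: n)
  also have "(\<Sum>i<r. of_nat (u ! Suc i) * (y * y ^ (r - Suc i))) = S"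
    unfolding S_def by (rule sum.cong) (auto simp flip: power_Suc simp: Suc_diff_Suc)
  finally have 2: "y * tuple_val y u = of_nat (u ! 0) * y ^ n + S" .
  show ?thesis
    by (rule ideal2I[of _ _ "\<Sum>i<n. of_nat (c i) * y ^ (r - i)" _ "of_nat (u ! 0)"])
      (simp add: distrib_right 1 2, simp add: algebra_simps)
qed

lemma tuple_val_funpow_ducci:
  fixes y :: "'a::comm_ring_1"
  assumes "u \<in> Zmod_tuples m n" "m \<ge> 1" "n \<ge> 1"
  shows "(1 + y) ^ a * tuple_val y u - tuple_val y ((ducci m ^^ a) u) \<in> ideal2 (of_nat m) (y ^ n - 1)"
proof (induction a)
  case 0
  show ?case by (rule ideal2I[of _ _ 0 _ 0]) simp
next
  case (Suc a)
  let ?v = "(ducci m ^^ a) u"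
  have "length ?v = n" using ducci_funpow_closed[OF assms(2,1)] by (simp add: Zmod_tuples_def)
  from ideal2_add[OF ideal2_mult[OF Suc, of "1 + y"] tuple_val_ducci[OF this assms(3)]]
  show ?case by (simp add: right_diff_distrib ac_simps)
qed

lemma tuple_val_basic: "tuple_val y (replicate r 0 @ [x]) = of_nat x"
  by (simp add: tuple_val_def nth_append)

lemma coeff_tuple_val:
  "coeff (tuple_val (monom 1 1 :: int poly) u) j = (if j < length u then int (u ! (length u - 1 - j)) else 0)"
proof -
  have "coeff (tuple_val (monom 1 1 :: int poly) u) j
      = (\<Sum>i<length u. if length u - 1 - i = j then int (u ! i) else 0)"
    by (simp add: tuple_val_def coeff_sum of_nat_monom monom_power mult_monom)
  also have "\<dots> = (\<Sum>i<length u. if i = length u - 1 - j \<and> j < length u then int (u ! i) else 0)"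
    by (intro sum.cong) auto
  also have "\<dots> = (if j < length u then int (u ! (length u - 1 - j)) else 0)"
    by (auto simp: sum.delta)
  finally show ?thesis .
qed

text \<open>In \<open>P = m * A + (X ^ n - 1) * B\<close> the coefficients of \<open>B\<close> at
  \<open>j\<close> and \<open>j + n\<close> agree modulo \<open>m\<close>, since \<open>P\<close>
  vanishes from \<open>n\<close> on. They are 0 far out, so \<open>m\<close> divides all of
  \<open>B\<close>. Thus residues have unique representatives of degree below
  \<open>n\<close>.\<close>

lemma int_dvd_coeff_of_ideal2:
  fixes P :: "int poly"
  assumes "P \<in> ideal2 (of_nat m) (monom 1 1 ^ n - 1)" "n \<ge> 1" "\<And>j. j \<ge> n \<Longrightarrow> coeff P j = 0"
  shows "int m dvd coeff P j"
proof -
  obtain A B where P: "P = of_nat m * A + (monom 1 1 ^ n - 1) * B"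
    using assms(1) by (elim ideal2E)
  have c: "coeff P j = int m * coeff A j + (if j < n then 0 else coeff B (j - n)) - coeff B j" for j
    unfolding P by (simp add: of_nat_poly monom_power coeff_monom_mult left_diff_distrib)
  have step: "int m dvd coeff B j" if "int m dvd coeff B (j + n)" for j
  proof -
    have "coeff B j = coeff B (j + n) - int m * coeff A (j + n)"
      using c[of "j + n"] assms(3)[of "j + n"] by simp
    then show ?thesis using that by simp
  qed
  have "int m dvd coeff B (j + n * t) \<Longrightarrow> int m dvd coeff B j" for j t
  proof (induction t)
    case (Suc t)
    then show ?case using step[of "j + n * t"] by (simp add: ac_simps)
  qed simp
  moreover have "coeff B (j + n * Suc (degree B)) = 0" for j
  proof (rule coeff_eq_0)
    have "degree B < n * Suc (degree B)" using assms(2) by (cases n) auto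
    then show "degree B < j + n * Suc (degree B)" by (rule trans_less_add2)
  qed
  ultimately have "int m dvd coeff B j" for j by (metis dvd_0_right)
  then show ?thesis unfolding c by simp
qed

lemma tuple_val_inj:
  assumes "u \<in> Zmod_tuples m n" "v \<in> Zmod_tuples m n" "n \<ge> 1"
    and "tuple_val (monom 1 1) u - tuple_val (monom 1 1) v \<in> ideal2 (of_nat m :: int poly) (monom 1 1 ^ n - 1)"
  shows "u = v"
proof (rule nth_equalityI)
  have l: "length u = n" "length v = n" using assms by (auto simp: Zmod_tuples_def)
  then show "length u = length v" by simp
  fix i assume i: "i < length u"
  have "int m dvd coeff (tuple_val (monom 1 1) u - tuple_val (monom 1 1) v) (n - 1 - i)"
    using assms(3,4) l by (intro int_dvd_coeff_of_ideal2) (auto simp: coeff_tuple_val simp del: One_nat_def)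
  then have "int m dvd int (u ! i) - int (v ! i)"
    using i l by (simp add: coeff_tuple_val del: One_nat_def)
  then have "u ! i mod m = v ! i mod m"
    by (metis mod_eq_dvd_iff of_nat_eq_iff zmod_int)
  moreover have "u ! i < m" "v ! i < m"
    using assms i l by (auto simp: Zmod_tuples_def subset_iff)
  ultimately show "u ! i = v ! i" by simp
qed

lemma funpow_ducci_basic_eq_iff:
  fixes m n :: nat
  defines "u \<equiv> replicate (n - 1) 0 @ [1 mod m]"
  assumes "m \<ge> 1" "n \<ge> 1"
  shows "(ducci m ^^ a) u = (ducci m ^^ b) u \<longleftrightarrow>
     (1 + monom 1 1) ^ a - (1 + monom 1 1) ^ b \<in> ideal2 (of_nat m :: int poly) (monom 1 1 ^ n - 1)"
proof -
  let ?X = "monom 1 1 :: int poly"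
  let ?I = "ideal2 (of_nat m :: int poly) (?X ^ n - 1)"
  have u: "u \<in> Zmod_tuples m n"
    unfolding u_def using assms by (intro basic_tuple_in_Zmod_tuples)
  \<comment> \<open>The quotient \<open>1 div m\<close> is nonzero only for \<open>m = 1\<close>,
    where the last entry is 0.\<close>
  have "1 - tuple_val ?X u \<in> ?I"
    by (rule ideal2I[of _ _ "of_nat (1 div m)" _ 0]) (simp only: u_def tuple_val_basic of_nat_mod_conv, simp)
  then have *: "(1 + ?X) ^ a - tuple_val ?X ((ducci m ^^ a) u) \<in> ?I" for a
    using ideal2_add[OF ideal2_mult[where c = "(1 + ?X) ^ a"]
        tuple_val_funpow_ducci[OF u assms(2,3), of ?X a]]
    by (fastforce simp: right_diff_distrib simp del: One_nat_def)
  show ?thesis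
  proof
    assume "(ducci m ^^ a) u = (ducci m ^^ b) u"
    then show "(1 + ?X) ^ a - (1 + ?X) ^ b \<in> ?I"
      using ideal2_diff[OF *[of a] *[of b]] by simp
  next
    assume "(1 + ?X) ^ a - (1 + ?X) ^ b \<in> ?I"
    from ideal2_add[OF ideal2_diff[OF this *[of a]] *[of b]]
    show "(ducci m ^^ a) u = (ducci m ^^ b) u"
      using ducci_funpow_closed[OF assms(2) u] assms(3)
      by (intro tuple_val_inj[of _ m n]) (simp_all add: algebra_simps)
  qed
qed

section \<open>Eventual periods and the length\<close>

definition ducci_period :: "nat \<Rightarrow> nat \<Rightarrow> nat \<Rightarrow> nat \<Rightarrow> bool" where
  "ducci_period m n a b \<longleftrightarrow> (1 + monom 1 1) ^ a * ((1 + monom 1 1) ^ b - 1)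
     \<in> ideal2 (of_nat m :: int poly) (monom 1 1 ^ n - 1)"

lemma ducci_period_mono:
  assumes "ducci_period m n a b" "a \<le> a'" "b dvd b'"
  shows "ducci_period m n a' b'"
proof -
  let ?z = "1 + monom 1 1 :: int poly"
  obtain c where c: "b' = b * c" using assms(3) by (elim dvdE)
  have "?z ^ b - 1 dvd ?z ^ b' - 1"
    unfolding c power_mult by (metis power_diff_1_eq dvd_triv_left)
  then obtain d where d: "?z ^ b' - 1 = (?z ^ b - 1) * d" by (elim dvdE)
  have "?z ^ a' = ?z ^ (a' - a) * ?z ^ a" using assms(2) by (simp flip: power_add)
  then have "?z ^ a' * (?z ^ b' - 1) = (?z ^ (a' - a) * d) * (?z ^ a * (?z ^ b - 1))"
    unfolding d by (simp only: ac_simps)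
  then show ?thesis
    using assms(1) ideal2_mult unfolding ducci_period_def by simp
qed

text \<open>Having an eventual period from \<open>a\<close> on is upward closed in \<open>a\<close>,
  so the least such \<open>a\<close> is determined by its upper bounds. Lengths are compared in this
  form from here on.\<close>

lemma ducci_L_le_iff:
  assumes "m \<ge> 1" "n \<ge> 1"
  shows "ducci_L m n \<le> a \<longleftrightarrow> (\<exists>b\<ge>1. ducci_period m n a b)"
proof -
  let ?u = "replicate (n - 1) 0 @ [1 mod m]"
  define Q where "Q a \<longleftrightarrow> (\<exists>b\<ge>1. ducci_period m n a b)" for a
  have "(ducci m ^^ (a + b)) ?u = (ducci m ^^ a) ?u \<longleftrightarrow> ducci_period m n a b" for a b
    using funpow_ducci_basic_eq_iff[OF assms, of "a + b" a]
    by (simp add: ducci_period_def power_add right_diff_distrib)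
  then have L: "ducci_L m n = (LEAST a. Q a)"
    and ex: "\<exists>a. Q a"
    using ducci_Len_exists[OF assms(1) basic_tuple_in_Zmod_tuples[OF assms]]
    unfolding ducci_L_def ducci_Len_def Q_def by auto
  have "Q (ducci_L m n)" unfolding L using ex by (rule LeastI_ex)
  then have "Q a" if "ducci_L m n \<le> a"
    using ducci_period_mono[OF _ that dvd_refl] unfolding Q_def by metis
  moreover have "ducci_L m n \<le> a" if "Q a"
    unfolding L using that by (rule Least_le)
  ultimately show ?thesis unfolding Q_def by blast
qed

text \<open>The Chinese remainder argument requires one common period for both moduli; the product
  of two periods is one.\<close>

lemma ducci_L_mult_le_iff:
  assumes "coprime m m'" "m \<ge> 1" "m' \<ge> 1" "n \<ge> 1"
  shows "ducci_L (m * m') n \<le> a \<longleftrightarrow> ducci_L m n \<le> a \<and> ducci_L m' n \<le> a"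
proof -
  have "(\<exists>b\<ge>1. ducci_period (m * m') n a b) \<longleftrightarrow>
      (\<exists>b\<ge>1. ducci_period m n a b \<and> ducci_period m' n a b)"
    using assms(1) unfolding ducci_period_def by (simp only: ideal2_coprime_iff)
  also have "\<dots> \<longleftrightarrow> (\<exists>b\<ge>1. ducci_period m n a b) \<and> (\<exists>b\<ge>1. ducci_period m' n a b)"
  proof safe
    fix b b' :: nat assume "b \<ge> 1" "b' \<ge> 1" "ducci_period m n a b" "ducci_period m' n a b'"
    then show "\<exists>b\<ge>1. ducci_period m n a b \<and> ducci_period m' n a b"
      by (intro exI[of _ "b * b'"]) (auto elim: ducci_period_mono)
  qed auto
  finally show ?thesis using assms by (simp add: ducci_L_le_iff)
qed

lemma ducci_L_prod_le_iff:
  assumes "finite S" "n \<ge> 1" "\<And>i. i \<in> S \<Longrightarrow> f i \<ge> 1"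
    and "\<And>i j. i \<in> S \<Longrightarrow> j \<in> S \<Longrightarrow> i \<noteq> j \<Longrightarrow> coprime (f i) (f j)"
  shows "ducci_L (prod f S) n \<le> a \<longleftrightarrow> (\<forall>i\<in>S. ducci_L (f i) n \<le> a)"
  using assms(1,3,4)
proof (induction S)
  case empty
  \<comment> \<open>The empty product is the modulus 1, whose ideal is the whole ring.\<close>
  have "ducci_period 1 n a 1" by (auto simp: ducci_period_def intro!: ideal2I[of _ _ _ _ 0])
  then show ?case using assms(2) by (auto simp: ducci_L_le_iff)
next
  case (insert i S)
  have "coprime (f i) (prod f S)" using insert.prems insert.hyps by (intro prod_coprime_right) auto
  moreover have "prod f S \<ge> 1" using insert.prems by (intro prod_ge_1) auto
  moreover have "f i \<ge> 1" using insert.prems by simp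
  ultimately have "ducci_L (f i * prod f S) n \<le> a \<longleftrightarrow> ducci_L (f i) n \<le> a \<and> ducci_L (prod f S) n \<le> a"
    using assms(2) by (intro ducci_L_mult_le_iff)
  with insert show ?case by simp
qed

section \<open>Bounds for the length\<close>

text \<open>At \<open>X = -1\<close> both \<open>1 + X\<close> and, for even \<open>n\<close>,
  \<open>X ^ n - 1\<close> vanish. A period starting at 0 would therefore make \<open>m\<close>
  divide \<open>-1\<close>.\<close>

lemma ducci_L_pos:
  assumes "even n" "n \<ge> 1" "m \<ge> 2"
  shows "ducci_L m n \<ge> 1"
proof (rule ccontr)
  let ?X = "monom 1 1 :: int poly"
  assume "\<not> ?thesis"
  then obtain b where b: "b \<ge> 1" "ducci_period m n 0 b"
    using ducci_L_le_iff[of m n 0] assms by auto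
  then obtain A B where AB: "(1 + ?X) ^ 0 * ((1 + ?X) ^ b - 1) = of_nat m * A + (?X ^ n - 1) * B"
    unfolding ducci_period_def by (elim ideal2E)
  from arg_cong[OF AB, of "\<lambda>P. poly P (-1)"] have "- 1 = int m * poly A (-1)"
    using b(1) assms(1) by (simp add: poly_monom power_0_left)
  then have "int m dvd - 1" by (metis dvd_triv_left)
  then show False using assms(3) by simp
qed

text \<open>Modulo \<open>g = \<Sum>i<n\<^sub>1. Y ^ (q * i)\<close> the element \<open>1 - Y\<close> is a unit, because \<open>g\<close> is congruent to
  \<open>n\<^sub>1\<close> modulo \<open>1 - Y\<close>; being of finite multiplicative order there, its powers return to \<open>1\<close>.\<close>

lemma ducci_L_le_nilpotency:
  fixes Y :: "int poly"
  defines "Y \<equiv> - monom 1 1"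
  assumes "even n" "n \<ge> 1" "m \<ge> 1" "n = q * n1" "coprime n1 m"
    and nil: "(Y - 1) ^ N \<in> ideal2 (of_nat m) (Y ^ q - 1)"
  shows "ducci_L m n \<le> N"
proof -
  define z where "z = 1 - Y"
  define g where "g = (\<Sum>i<n1. (Y ^ q) ^ i)"
  have zX: "1 + monom 1 1 = z" by (simp add: z_def Y_def)
  have "Y ^ n = monom 1 1 ^ n" using assms(2) by (simp add: Y_def)
  then have h: "monom 1 1 ^ n - 1 = (Y ^ q - 1) * g"
    unfolding g_def power_diff_1_eq[symmetric] by (simp add: assms(5) power_mult)
  \<comment> \<open>Any eventual period serves: once the power of \<open>z\<close> in front is
    cancelled modulo \<open>m\<close> and \<open>g\<close>, it gives \<open>z ^ b = 1\<close>
    there.\<close>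
  obtain b where b: "b \<ge> 1" "ducci_period m n (ducci_L m n) b"
    using ducci_L_le_iff[of m n "ducci_L m n"] assms by auto
  have zg: "z ^ ducci_L m n * (z ^ b - 1) \<in> ideal2 (of_nat m) g"
    using b(2) unfolding ducci_period_def h zX by (rule ideal2_mono) simp_all
  have "z dvd (Y ^ q) ^ i - 1" for i
  proof -
    have "Y - 1 dvd Y ^ (q * i) - 1" by (metis power_diff_1_eq dvd_triv_left)
    moreover have "z = - (Y - 1)" by (simp add: z_def)
    ultimately show ?thesis by (simp only: power_mult minus_dvd_iff)
  qed
  then have "z dvd (\<Sum>i<n1. (Y ^ q) ^ i - 1)" by (intro dvd_sum) simp
  also have "(\<Sum>i<n1. (Y ^ q) ^ i - 1) = g - of_nat n1" by (simp add: g_def sum_subtractf)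
  finally obtain d where d: "g - of_nat n1 = z * d" by (elim dvdE)
  obtain s t :: int where st: "of_int s * of_nat n1 + of_int t * of_nat m = (1 :: int poly)"
    using coprime_bezout_of_int[OF assms(6)] .
  \<comment> \<open>This is the inverse of \<open>z\<close> modulo \<open>m\<close> and
    \<open>g\<close>, where \<open>n1 = - z * d\<close> and \<open>s * n1 = 1\<close>.\<close>
  define v where "v = - (d * of_int s)"
  have "1 = of_int s * (g - z * d) + of_int t * of_nat m"
    unfolding d[symmetric] using st by simp
  then have vz: "v * z = 1 - of_nat m * of_int t - g * of_int s"
    by (simp add: v_def algebra_simps)
  have unit: "x \<in> ideal2 (of_nat m) g" if "z ^ a * x \<in> ideal2 (of_nat m) g" for a x
    using that
  proof (induction a)
    case (Suc a)
    have "z ^ a * x = v * (z ^ Suc a * x) + (z ^ a * x) * (1 - v * z)"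
      by (simp add: algebra_simps)
    moreover have "1 - v * z \<in> ideal2 (of_nat m) g"
      by (rule ideal2I[of _ _ "of_int t" _ "of_int s"]) (simp add: vz)
    ultimately have "z ^ a * x \<in> ideal2 (of_nat m) g"
      using Suc.prems ideal2_add ideal2_mult by metis
    then show ?case by (rule Suc.IH)
  qed simp
  obtain A B where AB: "z ^ b - 1 = of_nat m * A + g * B"
    using unit[OF zg] by (elim ideal2E)
  have "z ^ N = (- 1) ^ N * (Y - 1) ^ N"
    unfolding z_def power_mult_distrib[symmetric] by simp
  then have "z ^ N \<in> ideal2 (of_nat m) (Y ^ q - 1)" using ideal2_mult[OF nil] by simp
  then obtain A' B' where AB': "z ^ N = of_nat m * A' + (Y ^ q - 1) * B'" by (elim ideal2E)
  \<comment> \<open>One factor vanishes modulo \<open>m\<close> and \<open>Y ^ q - 1\<close>, the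
    other modulo \<open>m\<close> and \<open>g\<close>, so the product vanishes modulo
    \<open>m\<close> and \<open>(Y ^ q - 1) * g\<close>.\<close>
  have "z ^ N * (z ^ b - 1) = of_nat m * (A' * (z ^ b - 1) + (Y ^ q - 1) * B' * A)
      + ((Y ^ q - 1) * g) * (B' * B)"
    unfolding AB' by (simp add: algebra_simps AB)
  then have "ducci_period m n N b"
    unfolding ducci_period_def h zX by (rule ideal2I)
  with b(1) show ?thesis using assms by (auto simp: ducci_L_le_iff)
qed

text \<open>Modulo \<open>p\<close>, \<open>Y ^ q - 1\<close> is \<open>z ^ q\<close> up to sign. If
  \<open>a < q\<close>, then \<open>z ^ a\<close> can be cancelled, and what remains still has a
  factor \<open>z\<close> in every term except \<open>-1\<close>; evaluation at
  \<open>X = -1\<close>, where \<open>z = 0\<close>, gives a contradiction.\<close>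

lemma prime_power_le_ducci_L:
  assumes "prime p" "even n" "n \<ge> 1" "p ^ k dvd n"
  shows "p ^ k \<le> ducci_L p n"
proof (rule ccontr)
  define Y :: "int poly" where "Y = - monom 1 1"
  define z where "z = 1 - Y"
  define q where "q = p ^ k"
  define a where "a = ducci_L p n"
  assume "\<not> ?thesis"
  then have aq: "a < q" by (simp add: a_def q_def)
  have zX: "1 + monom 1 1 = z" by (simp add: z_def Y_def)
  have p1: "p \<ge> 1" using prime_ge_1_nat[OF assms(1)] .
  obtain b where b: "b \<ge> 1" "ducci_period p n a b"
    using ducci_L_le_iff[OF p1 assms(3), of a] by (auto simp: a_def)
  obtain n1 where n1: "n = q * n1" using assms(4) by (auto simp: q_def)
  have "Y ^ n = monom 1 1 ^ n" using assms(2) by (simp add: Y_def)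
  then have "Y ^ q - 1 dvd monom 1 1 ^ n - 1"
    unfolding n1 power_mult by (metis power_diff_1_eq dvd_triv_left)
  then have "z ^ a * (z ^ b - 1) \<in> ideal2 (of_nat p) (Y ^ q - 1)"
    using b(2) unfolding ducci_period_def zX by (elim ideal2_mono) simp_all
  then obtain A B where AB: "z ^ a * (z ^ b - 1) = of_nat p * A + (Y ^ q - 1) * B" by (elim ideal2E)
  obtain c where "(Y - 1 + 1) ^ q = (Y - 1) ^ q + 1 + of_nat p * c"
    unfolding q_def using add_one_power_prime_power[OF assms(1)] by blast
  moreover have "(Y - 1) ^ q = z ^ q * (- 1) ^ q"
    unfolding z_def power_mult_distrib[symmetric] by simp
  moreover have "z ^ q = z ^ a * z ^ (q - a)" using aq by (simp flip: power_add)
  ultimately have "Y ^ q - 1 = z ^ a * z ^ (q - a) * (- 1) ^ q + of_nat p * c" by simp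
  define R where "R = z ^ b - 1 - z ^ (q - a) * (- 1) ^ q * B"
  have "z ^ a * R = of_nat p * (A + c * B)"
    using AB unfolding R_def \<open>Y ^ q - 1 = _\<close> by (simp add: algebra_simps)
  then have "[:int p:] dvd z ^ a * R" by (simp only: of_nat_poly of_nat_id dvd_triv_left)
  \<comment> \<open>By Gauss's lemma the constant \<open>p\<close> stays prime in the polynomial
    ring, which allows the cancellation of \<open>z ^ a\<close>.\<close>
  moreover have "prime_elem [:int p:]"
    using assms(1) by (intro lift_prime_elem_poly) (simp add: prime_imp_prime_elem)
  ultimately consider "[:int p:] dvd z" | "[:int p:] dvd R"
    by (metis prime_elem_dvd_mult_iff prime_elem_dvd_power)
  then show False
  proof cases
    case 1
    then have "int p dvd coeff z 0" unfolding const_poly_dvd_iff by blast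
    then show ?thesis using assms(1) by (simp add: z_def Y_def)
  next
    case 2
    then obtain T where "R = [:int p:] * T" by (elim dvdE)
    from arg_cong[OF this, of "\<lambda>P. poly P (-1)"] have "- 1 = int p * poly T (-1)"
      using b(1) aq by (simp add: R_def z_def Y_def poly_monom power_0_left)
    then have "int p dvd - 1" by (metis dvd_triv_left)
    then show ?thesis using assms(1) by simp
  qed
qed

section \<open>Lengths for the various factorizations\<close>

text \<open>For \<open>q = 1\<close> the element \<open>Y - 1\<close> is itself the second
  generator, so the exponent 1 suffices.\<close>

lemma ducci_L_le_1:
  assumes "even n" "n \<ge> 1" "m \<ge> 1" "coprime n m"
  shows "ducci_L m n \<le> 1"
  using assms by (intro ducci_L_le_nilpotency[where q = 1 and ?n1.0 = n])
    (auto intro: ideal2I[of _ _ 0 _ 1])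

lemma ducci_L_prime_power_le:
  assumes "prime p" "even n" "n \<ge> 1" "n = p ^ Suc j * n1" "\<not> p dvd n1"
  shows "ducci_L (p ^ l) n \<le> p ^ j * (l * (p - 1) + 1)"
proof (rule ducci_L_le_nilpotency)
  show "coprime n1 (p ^ l)"
    using prime_imp_coprime[OF assms(1,5)] by (simp add: coprime_commute)
  show "1 \<le> p ^ l" using prime_ge_1_nat[OF assms(1)] by simp
qed (use assms diff_one_power_in_ideal2 in auto)

text \<open>The cofactor \<open>m1\<close> is coprime to \<open>n\<close> and contributes at most 1,
  which never exceeds the bound for \<open>p ^ l\<close>.\<close>

lemma ducci_L_le_prime_power_factor:
  assumes "prime p" "even n" "n \<ge> 1" "n = p ^ Suc j * n1" "m1 \<ge> 1"
    and "coprime n1 m1" "\<not> p dvd n1" "\<not> p dvd m1"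
  shows "ducci_L (p ^ l * m1) n \<le> p ^ j * (l * (p - 1) + 1)"
proof -
  have cop: "coprime p m1" using assms by (simp add: prime_imp_coprime)
  then have "coprime n m1" using assms by simp
  then have "ducci_L m1 n \<le> 1" using assms by (intro ducci_L_le_1)
  also have "1 \<le> p ^ j * (l * (p - 1) + 1)"
    using prime_gt_0_nat[OF assms(1)] by (simp only: Suc_le_eq One_nat_def nat_0_less_mult_iff) simp
  finally show ?thesis
    using ducci_L_mult_le_iff[of "p ^ l" m1 n] ducci_L_prime_power_le[of p n j n1 l] cop assms
      prime_ge_1_nat[OF assms(1)] by simp
qed

text \<open>For \<open>l = 1\<close> the upper bound \<open>p ^ j * (p - 1 + 1)\<close> meets the
  lower bound \<open>p ^ Suc j\<close>.\<close>

lemma ducci_L_prime_factor: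
  assumes "prime p" "even n" "n \<ge> 1" "n = p ^ Suc j * n1" "m1 \<ge> 1"
    and "coprime n1 m1" "\<not> p dvd n1" "\<not> p dvd m1"
  shows "ducci_L (p * m1) n = p ^ Suc j"
proof (rule antisym)
  have "p ^ j * (1 * (p - 1) + 1) = p ^ Suc j"
    using prime_gt_0_nat[OF assms(1)] by simp
  then show "ducci_L (p * m1) n \<le> p ^ Suc j"
    using ducci_L_le_prime_power_factor[OF assms, of 1] by simp
  have "p ^ Suc j \<le> ducci_L p n"
    using assms by (intro prime_power_le_ducci_L) auto
  also have "\<dots> \<le> ducci_L (p * m1) n"
    using ducci_L_mult_le_iff[of p m1 n "ducci_L (p * m1) n"] assms prime_ge_1_nat[OF assms(1)]
    by (simp add: prime_imp_coprime)
  finally show "p ^ Suc j \<le> ducci_L (p * m1) n" .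
qed

text \<open>The part \<open>m1\<close> is absorbed by the maximum: it contributes at most 1, while
  every prime power contributes at least 1 and \<open>S\<close> is nonempty.\<close>

lemma ducci_L_eq_Max:
  fixes p :: "'i \<Rightarrow> nat"
  assumes "even n" "n \<ge> 1" "finite S" "S \<noteq> {}" "inj_on p S"
    and "\<And>i. i \<in> S \<Longrightarrow> prime (p i)" "\<And>i. i \<in> S \<Longrightarrow> l i \<ge> 1"
    and "m1 \<ge> 1" "n = (\<Prod>i\<in>S. p i ^ k i) * n1" "coprime n1 m1" "\<And>i. i \<in> S \<Longrightarrow> \<not> p i dvd m1"
  shows "ducci_L ((\<Prod>i\<in>S. p i ^ l i) * m1) n = Max ((\<lambda>i. ducci_L (p i ^ l i) n) ` S)"
proof -
  let ?P = "\<Prod>i\<in>S. p i ^ l i"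
  have cop: "coprime (\<Prod>i\<in>S. p i ^ e i) m1" for e
    using assms(6,11) by (intro prod_coprime_left) (simp add: prime_imp_coprime)
  have "coprime n m1" unfolding assms(9) using cop assms(10) by simp
  then have m1: "ducci_L m1 n \<le> 1" using assms by (intro ducci_L_le_1)
  have ge1: "p i ^ l i \<ge> 1" if "i \<in> S" for i using prime_ge_1_nat[OF assms(6)[OF that]] by simp
  have P: "ducci_L ?P n \<le> a \<longleftrightarrow> (\<forall>i\<in>S. ducci_L (p i ^ l i) n \<le> a)" for a
  proof (rule ducci_L_prod_le_iff)
    fix i j assume ij: "i \<in> S" "j \<in> S" "i \<noteq> j"
    then have "p i \<noteq> p j" using assms(5) by (auto dest: inj_onD)
    then show "coprime (p i ^ l i) (p j ^ l j)" using assms(6) ij by (simp add: primes_coprime)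
  qed (use assms ge1 in auto)
  have "ducci_L (?P * m1) n \<le> a \<longleftrightarrow> (\<forall>i\<in>S. ducci_L (p i ^ l i) n \<le> a) \<and> ducci_L m1 n \<le> a" for a
    using ducci_L_mult_le_iff[OF cop prod_ge_1[OF ge1] assms(8,2)] P by simp
  moreover have "ducci_L m1 n \<le> a" if "\<forall>i\<in>S. ducci_L (p i ^ l i) n \<le> a" for a
  proof -
    obtain i where i: "i \<in> S" using assms(4) by blast
    have "p i ^ 1 \<le> p i ^ l i"
      using assms(7)[OF i] prime_ge_1_nat[OF assms(6)[OF i]] by (rule power_increasing)
    then have "p i ^ l i \<ge> 2" using prime_ge_2_nat[OF assms(6)[OF i]] by simp
    then have "1 \<le> ducci_L (p i ^ l i) n" using assms by (intro ducci_L_pos)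
    with m1 that i show ?thesis by force
  qed
  ultimately have "ducci_L (?P * m1) n \<le> a \<longleftrightarrow> Max ((\<lambda>i. ducci_L (p i ^ l i) n) ` S) \<le> a" for a
    using assms(3,4) by auto
  \<comment> \<open>Two numbers with the same upper bounds are equal.\<close>
  then show ?thesis by (metis antisym order_refl)
qed

theorem theorem2:
  fixes n m :: nat
  assumes "n \<ge> 2" and "even n" and "m \<ge> 2"
  shows "(gcd n m = 1 \<longrightarrow> ducci_L m n = 1)
    \<and> (\<forall>p k n1 m1 :: nat.
          prime p \<and> k \<ge> 1 \<and> n1 \<ge> 1 \<and> m1 \<ge> 1
          \<and> n = p ^ k * n1 \<and> m = p * m1
          \<and> gcd n1 m1 = 1 \<and> \<not> p dvd n1 \<and> \<not> p dvd m1
          \<longrightarrow> ducci_L m n = p ^ k)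
    \<and> (\<forall>p k l n1 m1 :: nat.
          prime p \<and> k \<ge> 1 \<and> l \<ge> 1 \<and> n1 \<ge> 1 \<and> m1 \<ge> 1
          \<and> n = p ^ k * n1 \<and> m = p ^ l * m1
          \<and> gcd n1 m1 = 1 \<and> \<not> p dvd n1 \<and> \<not> p dvd m1
          \<longrightarrow> ducci_L m n \<le> p ^ (k - 1) * (l * (p - 1) + 1))
    \<and> (\<forall>(t :: nat) (p :: nat \<Rightarrow> nat) (k :: nat \<Rightarrow> nat) (l :: nat \<Rightarrow> nat) (n1 :: nat) (m1 :: nat).
          t \<ge> 1
          \<and> (\<forall>i\<in>{1..t}. prime (p i) \<and> k i \<ge> 1 \<and> l i \<ge> 1)
          \<and> strict_mono_on {1..t} p
          \<and> n1 \<ge> 1 \<and> m1 \<ge> 1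
          \<and> n = (\<Prod>i=1..t. p i ^ k i) * n1
          \<and> m = (\<Prod>i=1..t. p i ^ l i) * m1
          \<and> gcd n1 m1 = 1
          \<and> (\<forall>i\<in>{1..t}. \<not> p i dvd n1 \<and> \<not> p i dvd m1)
          \<longrightarrow> ducci_L m n = Max {ducci_L (p i ^ l i) n | i. 1 \<le> i \<and> i \<le> t})"
proof (intro conjI allI impI)
  have n: "n \<ge> 1" using assms(1) by simp
  show "ducci_L m n = 1" if "gcd n m = 1"
    using ducci_L_le_1[of n m] ducci_L_pos[of n m] that assms n
    by (simp add: coprime_iff_gcd_eq_1)
  show "ducci_L m n = p ^ k"
    if "prime p \<and> k \<ge> 1 \<and> n1 \<ge> 1 \<and> m1 \<ge> 1 \<and> n = p ^ k * n1 \<and> m = p * m1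
      \<and> gcd n1 m1 = 1 \<and> \<not> p dvd n1 \<and> \<not> p dvd m1" for p k n1 m1
    using ducci_L_prime_factor[of p n "k - 1" n1 m1] that assms(2) n
    by (simp add: coprime_iff_gcd_eq_1)
  show "ducci_L m n \<le> p ^ (k - 1) * (l * (p - 1) + 1)"
    if "prime p \<and> k \<ge> 1 \<and> l \<ge> 1 \<and> n1 \<ge> 1 \<and> m1 \<ge> 1 \<and> n = p ^ k * n1 \<and> m = p ^ l * m1
      \<and> gcd n1 m1 = 1 \<and> \<not> p dvd n1 \<and> \<not> p dvd m1" for p k l n1 m1
    using ducci_L_le_prime_power_factor[of p n "k - 1" n1 m1 l] that assms(2) n
    by (simp add: coprime_iff_gcd_eq_1)
  fix t n1 m1 :: nat and p k l :: "nat \<Rightarrow> nat"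
  assume *: "t \<ge> 1
          \<and> (\<forall>i\<in>{1..t}. prime (p i) \<and> k i \<ge> 1 \<and> l i \<ge> 1)
          \<and> strict_mono_on {1..t} p
          \<and> n1 \<ge> 1 \<and> m1 \<ge> 1
          \<and> n = (\<Prod>i=1..t. p i ^ k i) * n1
          \<and> m = (\<Prod>i=1..t. p i ^ l i) * m1
          \<and> gcd n1 m1 = 1
          \<and> (\<forall>i\<in>{1..t}. \<not> p i dvd n1 \<and> \<not> p i dvd m1)"
  have "ducci_L ((\<Prod>i=1..t. p i ^ l i) * m1) n = Max ((\<lambda>i. ducci_L (p i ^ l i) n) ` {1..t})"
    using * assms(2) n
    by (intro ducci_L_eq_Max[where k = k and ?n1.0 = n1])
      (auto simp: coprime_iff_gcd_eq_1 intro: strict_mono_on_imp_inj_on)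
  moreover have "(\<lambda>i. ducci_L (p i ^ l i) n) ` {1..t} = {ducci_L (p i ^ l i) n | i. 1 \<le> i \<and> i \<le> t}"
    by auto
  ultimately show "ducci_L m n = Max {ducci_L (p i ^ l i) n | i. 1 \<le> i \<and> i \<le> t}"
    using * by simp
qed

end
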